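(* Let $\mathcal{G}$ be a strongly connected and weight-balanced weighted digraph on $N$ nodes with Laplacian $L=[L_{ij}]$. Let the inputs $u^i:[0,\infty)\to\mathbb{R}$, $i\in\{1,\dots,N\}$, be piecewise continuously differentiable with $\|\Pi_N\dot u\|_{\rm ess}=\gamma<\infty$. Then for any $\alpha,\beta>0$, every trajectory of $$\dot x^i=\dot u^i-\alpha(x^i-u^i)-\beta\sum_{j=1}^N L_{ij}x^j-v^i,\qquad \dot v^i=\alpha\beta\sum_{j=1}^N L_{ij}x^j,\qquad i\in\{1,\dots,N\},$$ initialized at $x^i(0),v^i(0)\in\mathbb{R}$ with $\sum_{i=1}^N v^i(0)=0$ satisfies $$\limsup_{t\to\infty}\Big|x^i(t)-\frac1N\sum_{j=1}^N u^j(t)\Big|\le(\beta\hat\lambda_2)^{-1}\gamma,\qquad i\in\{1,\dots,N\}.$$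
   Context: Weighted digraph $\mathcal{G}$ on nodes $\{1,\dots,N\}$, $N\ge2$: adjacency matrix $\mathsf{A}=[a_{ij}]$ with $a_{ij}>0$ if $(i,j)$ is an edge and $a_{ij}=0$ otherwise. Weight-balanced: $\sum_j a_{ij}=\sum_j a_{ji}$ for every $i$. Laplacian: $L=D^{\rm out}-\mathsf{A}$, where $D^{\rm out}$ is diagonal with entries $\sum_j a_{ij}$. $\hat\lambda_2>0$ is the smallest nonzero eigenvalue of $\frac12(L+L^\top)$ ($0$ is a simple eigenvalue of this matrix when $\mathcal{G}$ is strongly connected and weight-balanced). $\Pi_N=I_N-\frac1N\mathbf{1}_N\mathbf{1}_N^\top$ with $\mathbf{1}_N$ the vector of ones, $u=(u^1,\dots,u^N)$, and $\|f\|_{\rm ess}$ is the (essential) supremum over $t\ge0$ of the Euclidean norm $\|f(t)\|$. "Piecewise continuously differentiable" means continuous with a piecewise continuous derivative. *)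

theory Defs
  imports "HOL-Analysis.Analysis" "HOL-Probability.Essential_Supremum"
begin

subsection \<open>Weighted digraphs\<close>

text \<open>The nodes are the elements of a finite type. Self-loops are permitted; they cancel in the
  Laplacian.\<close>

definition weighted_digraph :: "('n \<times> 'n) set \<Rightarrow> real ^ 'n ^ 'n \<Rightarrow> bool" where
  "weighted_digraph E A \<longleftrightarrow>
     (\<forall>i j. if (i, j) \<in> E then A $ i $ j > 0 else A $ i $ j = 0)"

definition strongly_connected_digraph :: "('n \<times> 'n) set \<Rightarrow> bool" where
  "strongly_connected_digraph E \<longleftrightarrow> (\<forall>i j. (i, j) \<in> E\<^sup>*)"

definition weight_balanced :: "real ^ 'n ^ 'n \<Rightarrow> bool" where
  "weight_balanced A \<longleftrightarrow> (\<forall>i. (\<Sum>j\<in>UNIV. A $ i $ j) = (\<Sum>j\<in>UNIV. A $ j $ i))"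

definition out_degree_matrix :: "real ^ 'n ^ 'n \<Rightarrow> real ^ 'n ^ 'n" where
  "out_degree_matrix A = (\<chi> i j. if i = j then (\<Sum>k\<in>UNIV. A $ i $ k) else 0)"

definition laplacian :: "real ^ 'n ^ 'n \<Rightarrow> real ^ 'n ^ 'n" where
  "laplacian A = out_degree_matrix A - A"

definition real_eigenvalue :: "real ^ 'n ^ 'n \<Rightarrow> real \<Rightarrow> bool" where
  "real_eigenvalue M l \<longleftrightarrow> (\<exists>w. w \<noteq> 0 \<and> M *v w = l *\<^sub>R w)"

text \<open>The symmetric matrix below has only real eigenvalues, finitely many, and for at least two
  nodes and a strongly connected, weight-balanced digraph one of them is nonzero; so the least
  one exists.\<close>

definition lambda2_hat :: "real ^ 'n ^ 'n \<Rightarrow> real" where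
  "lambda2_hat A =
     (LEAST l. l \<noteq> 0 \<and>
        real_eigenvalue ((1/2) *\<^sub>R (laplacian A + transpose (laplacian A))) l)"

definition Pi_matrix :: "real ^ 'n ^ 'n" where
  "Pi_matrix = mat 1 - (1 / real CARD('n)) *\<^sub>R (\<chi> i j. 1)"

subsection \<open>Signals on the half-line\<close>

text \<open>Signals are functions of type \<open>real \<Rightarrow> _\<close> of which only the values on \<open>{0..}\<close> matter;
  accordingly derivatives are taken within \<open>{0..}\<close>.\<close>

definition time_deriv :: "(real \<Rightarrow> 'a::real_normed_vector) \<Rightarrow> real \<Rightarrow> 'a" where
  "time_deriv f t = vector_derivative f (at t within {0..})"

definition locally_finite_times :: "real set \<Rightarrow> bool" where
  "locally_finite_times S \<longleftrightarrow> (\<forall>T. finite (S \<inter> {0..T}))"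

definition piecewise_continuous :: "(real \<Rightarrow> 'a::real_normed_vector) \<Rightarrow> bool" where
  "piecewise_continuous g \<longleftrightarrow>
     (\<exists>S. locally_finite_times S \<and> continuous_on ({0..} - S) g \<and>
        (\<forall>t\<in>S. (t \<ge> 0 \<longrightarrow> (\<exists>l. (g \<longlongrightarrow> l) (at_right t))) \<and>
               (t > 0 \<longrightarrow> (\<exists>l. (g \<longlongrightarrow> l) (at_left t)))))"

text \<open>At the exceptional times where \<open>f\<close> is not differentiable, \<open>time_deriv f\<close> has an unspecified
  value; piecewise continuity does not depend on it.\<close>

definition piecewise_cont_differentiable :: "(real \<Rightarrow> 'a::real_normed_vector) \<Rightarrow> bool" where
  "piecewise_cont_differentiable f \<longleftrightarrow>
     continuous_on {0..} f \<and>
     (\<exists>S. locally_finite_times S \<and> (\<forall>t\<in>{0..} - S. f differentiable (at t within {0..}))) \<and>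
     piecewise_continuous (time_deriv f)"

text \<open>The library's essential supremum is \<open>top\<close> for non-measurable functions, so equating it with
  a real number below entails measurability.\<close>

definition ess_norm :: "(real \<Rightarrow> 'a::real_normed_vector) \<Rightarrow> ereal" where
  "ess_norm f = esssup (lebesgue_on {0..}) (\<lambda>t. ereal (norm (f t)))"

subsection \<open>The consensus dynamics\<close>

text \<open>The right-hand side jumps where the derivative of an input does, so a trajectory is a
  continuous curve satisfying the equations except at times from a locally finite set.\<close>

definition consensus_trajectory ::
  "real ^ 'n ^ 'n \<Rightarrow> real \<Rightarrow> real \<Rightarrow> (real \<Rightarrow> real ^ 'n) \<Rightarrow> (real \<Rightarrow> real ^ 'n) \<Rightarrow> (real \<Rightarrow> real ^ 'n) \<Rightarrow> bool"
  where
  "consensus_trajectory L \<alpha> \<beta> u x v \<longleftrightarrow>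
     continuous_on {0..} x \<and> continuous_on {0..} v \<and>
     (\<exists>S. locally_finite_times S \<and>
        (\<forall>t\<in>{0..} - S. \<forall>i.
           ((\<lambda>s. x s $ i) has_real_derivative
              (time_deriv (\<lambda>s. u s $ i) t - \<alpha> * (x t $ i - u t $ i)
                 - \<beta> * (\<Sum>j\<in>UNIV. L $ i $ j * x t $ j) - v t $ i)) (at t within {0..}) \<and>
           ((\<lambda>s. v s $ i) has_real_derivative
              (\<alpha> * \<beta> * (\<Sum>j\<in>UNIV. L $ i $ j * x t $ j))) (at t within {0..})))"

end

theory Submission
  imports Defs
begin

text \<open>
  The integral action \<open>v\<close> is eliminated by the combination \<open>s = x - u + v / \<alpha>\<close>. The factor
  \<open>\<alpha> * \<beta>\<close> in the equation for \<open>v\<close> is exactly what makes the two Laplacian terms cancel, so that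
  \<open>s' = - \<alpha> s\<close> and \<open>s\<close> decays exponentially. In terms of \<open>s\<close> the state obeys
  \<open>x' = u' - \<beta> L x - \<alpha> s\<close>: diffusion along the graph, driven by the rate of the inputs and a
  vanishing disturbance.

  Let \<open>\<Pi>\<close> be the projection onto the vectors of mean zero. Weight balance conserves the sum of the
  entries of \<open>v\<close>, which starts at zero, so the tracking error \<open>x - mean u\<close> is the disagreement
  \<open>p = \<Pi> x\<close> plus the mean of \<open>s\<close>, and only \<open>p\<close> matters in the limit. Put
  \<open>\<mu> = \<beta> \<lambda>\<close>, where \<open>\<lambda>\<close> is the smallest nonzero eigenvalue of the symmetrised
  Laplacian. On vectors of mean zero the quadratic form of \<open>L\<close> is at least \<open>\<lambda>\<close> times the squared
  norm (\<open>lambda2_hat_gap\<close>), hence with \<open>b = \<gamma> + \<alpha> \<parallel>s\<parallel>\<close>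
  one has \<open>(\<parallel>p\<parallel>\<^sup>2)' \<le> 2 b \<parallel>p\<parallel> - 2 \<mu> \<parallel>p\<parallel>\<^sup>2 \<le> b\<^sup>2 / \<mu> - \<mu> \<parallel>p\<parallel>\<^sup>2\<close>.
  The second step is Young's inequality, an equality at \<open>\<parallel>p\<parallel> = b / \<mu>\<close>, so working with the
  smooth function \<open>\<parallel>p\<parallel>\<^sup>2\<close> does not worsen the constant. As \<open>b\<close> tends to \<open>\<gamma>\<close>, comparison
  with the scalar linear equation (\<open>exponential_decay_off_locally_finite\<close>) yields the bound
  \<open>\<gamma> / \<mu>\<close> on the upper limit of \<open>\<parallel>p\<parallel>\<close>; the whole estimate is
  \<open>consensus_error_eventually_less\<close>.

  Two regularity points remain. All differential identities may fail on a locally finite set of times,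
  which the comparison argument tolerates because the functions compared are continuous. The
  hypothesis on the inputs bounds \<open>\<Pi> u'\<close> only almost everywhere; since \<open>u'\<close> is continuous off a
  locally finite set, the bound holds at every other time (\<open>ess_norm_pointwise_bound\<close>).
\<close>

section \<open>The Laplacian of a weight-balanced digraph\<close>

lemma inner_one_vec: "(1::real^'n::finite) \<bullet> y = (\<Sum>i\<in>UNIV. y $ i)"
  by (simp add: inner_vec_def)

lemma laplacian_mult_nth:
  fixes A :: "real^'n::finite^'n"
  shows "(laplacian A *v y) $ i = (\<Sum>j\<in>UNIV. A $ i $ j * (y $ i - y $ j))"
proof -
  have "(laplacian A *v y) $ i =
      (\<Sum>j\<in>UNIV. (if i = j then (\<Sum>k\<in>UNIV. A $ i $ k) * y $ j else 0) - A $ i $ j * y $ j)"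
    by (auto simp: laplacian_def out_degree_matrix_def matrix_vector_mult_def left_diff_distrib
        intro!: sum.cong)
  also have "\<dots> = (\<Sum>k\<in>UNIV. A $ i $ k) * y $ i - (\<Sum>j\<in>UNIV. A $ i $ j * y $ j)"
    by (simp add: sum_subtractf)
  also have "\<dots> = (\<Sum>j\<in>UNIV. A $ i $ j * (y $ i - y $ j))"
    by (simp add: right_diff_distrib sum_subtractf sum_distrib_right)
  finally show ?thesis .
qed

lemma laplacian_mult_one: "laplacian A *v (1::real^'n::finite) = 0"
  by (simp add: vec_eq_iff laplacian_mult_nth)

text \<open>Weight balance enters the development through this identity alone: the weight of the edges
  into a node may be exchanged for the weight of those out of it.\<close>

lemma weight_balanced_sum_swap:
  fixes A :: "real^'n::finite^'n"
  assumes "weight_balanced A"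
  shows "(\<Sum>i\<in>UNIV. \<Sum>j\<in>UNIV. A $ i $ j * f j) = (\<Sum>i\<in>UNIV. \<Sum>j\<in>UNIV. A $ i $ j * f i)"
proof -
  have "(\<Sum>i\<in>UNIV. \<Sum>j\<in>UNIV. A $ i $ j * f j) = (\<Sum>j\<in>UNIV. (\<Sum>i\<in>UNIV. A $ i $ j) * f j)"
    by (subst sum.swap) (simp add: sum_distrib_right)
  also have "\<dots> = (\<Sum>j\<in>UNIV. (\<Sum>i\<in>UNIV. A $ j $ i) * f j)"
    using assms by (simp add: weight_balanced_def)
  finally show ?thesis by (simp add: sum_distrib_right)
qed

lemma one_inner_laplacian:
  fixes A :: "real^'n::finite^'n"
  assumes "weight_balanced A"
  shows "1 \<bullet> (laplacian A *v y) = 0"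
  using weight_balanced_sum_swap[OF assms, of "\<lambda>j. y $ j"]
  by (simp add: inner_one_vec laplacian_mult_nth right_diff_distrib sum_subtractf)

text \<open>The Dirichlet form of the graph. Expanding the squares gives the terms with \<open>(y $ i)\<^sup>2\<close> and with
  \<open>(y $ j)\<^sup>2\<close>, which weight balance makes equal in total.\<close>

lemma laplacian_form:
  fixes A :: "real^'n::finite^'n"
  assumes "weight_balanced A"
  shows "y \<bullet> (laplacian A *v y) =
    (1/2) * (\<Sum>i\<in>UNIV. \<Sum>j\<in>UNIV. A $ i $ j * (y $ i - y $ j)\<^sup>2)"
proof -
  let ?S = "\<lambda>f. \<Sum>i\<in>UNIV. \<Sum>j\<in>UNIV. A $ i $ j * f i j"
  have "y \<bullet> (laplacian A *v y) = ?S (\<lambda>i j. (y $ i)\<^sup>2 - y $ i * y $ j)"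
    by (auto simp: inner_vec_def laplacian_mult_nth sum_distrib_left power2_eq_square
        algebra_simps intro!: sum.cong)
  also have "\<dots> = ?S (\<lambda>i j. (y $ i)\<^sup>2) - ?S (\<lambda>i j. y $ i * y $ j)"
    by (simp add: right_diff_distrib sum_subtractf)
  finally have 1: "y \<bullet> (laplacian A *v y) = ?S (\<lambda>i j. (y $ i)\<^sup>2) - ?S (\<lambda>i j. y $ i * y $ j)" .
  have "?S (\<lambda>i j. (y $ i - y $ j)\<^sup>2) =
      ?S (\<lambda>i j. (y $ i)\<^sup>2) + ?S (\<lambda>i j. (y $ j)\<^sup>2) - 2 * ?S (\<lambda>i j. y $ i * y $ j)"
    by (simp add: power2_diff distrib_left right_diff_distrib sum_subtractf sum.distrib
        sum_distrib_left algebra_simps)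
  also have "\<dots> = 2 * (?S (\<lambda>i j. (y $ i)\<^sup>2) - ?S (\<lambda>i j. y $ i * y $ j))"
    using weight_balanced_sum_swap[OF assms, of "\<lambda>j. (y $ j)\<^sup>2"] by simp
  finally show ?thesis using 1 by simp
qed

text \<open>If the Dirichlet form vanishes, then \<open>y\<close> takes equal values at the ends of every edge, hence
  along every path, hence everywhere by strong connectivity; and the only constant vector of mean
  zero is zero.\<close>

lemma laplacian_form_pos:
  fixes A :: "real^'n::finite^'n"
  assumes E: "weighted_digraph E A" and conn: "strongly_connected_digraph E"
    and bal: "weight_balanced A" and orth: "1 \<bullet> y = 0" and nz: "y \<noteq> 0"
  shows "y \<bullet> (laplacian A *v y) > 0"
proof -
  have A0: "A $ i $ j \<ge> 0" for i j
    using E unfolding weighted_digraph_def by (metis less_imp_le order_refl)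
  have "y \<bullet> (laplacian A *v y) \<noteq> 0"
  proof
    assume "y \<bullet> (laplacian A *v y) = 0"
    then have "(\<Sum>i\<in>UNIV. \<Sum>j\<in>UNIV. A $ i $ j * (y $ i - y $ j)\<^sup>2) = 0"
      using laplacian_form[OF bal] by simp
    then have z: "A $ i $ j * (y $ i - y $ j)\<^sup>2 = 0" for i j
      using A0 by (simp add: sum_nonneg_eq_0_iff sum_nonneg)
    have edge: "y $ i = y $ j" if "(i, j) \<in> E" for i j
      using z[of i j] E that unfolding weighted_digraph_def
      by (metis eq_iff_diff_eq_0 less_irrefl mult_eq_0_iff power_eq_0_iff)
    have const: "y $ i = y $ j" for i j
    proof -
      have "(i, j) \<in> E\<^sup>*" using conn unfolding strongly_connected_digraph_def by blast
      then show ?thesis by (induction rule: rtrancl_induct) (auto dest: edge)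
    qed
    have "y $ i = 0" for i
    proof -
      have "1 \<bullet> y = (\<Sum>j\<in>(UNIV::'n set). y $ i)"
        unfolding inner_one_vec by (intro sum.cong) (auto simp: const)
      then show ?thesis using orth by simp
    qed
    then show False using nz by (simp add: vec_eq_iff)
  qed
  moreover have "y \<bullet> (laplacian A *v y) \<ge> 0"
    unfolding laplacian_form[OF bal] using A0 by (auto intro!: mult_nonneg_nonneg sum_nonneg)
  ultimately show ?thesis by linarith
qed

section \<open>The spectral gap as a minimum of the Rayleigh quotient\<close>

definition laplacian_sym :: "real^'n::finite^'n \<Rightarrow> real^'n^'n" where
  "laplacian_sym A = (1/2) *\<^sub>R (laplacian A + transpose (laplacian A))"

lemma laplacian_sym_mult:
  "laplacian_sym A *v y = (1/2) *\<^sub>R (laplacian A *v y + transpose (laplacian A) *v y)"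
  by (simp add: laplacian_sym_def matrix_vector_mult_add_rdistrib
      scaleR_matrix_vector_assoc[symmetric])

lemma laplacian_sym_self_adjoint: "x \<bullet> (laplacian_sym A *v y) = y \<bullet> (laplacian_sym A *v x)"
proof -
  have "a \<bullet> (transpose (laplacian A) *v b) = b \<bullet> (laplacian A *v a)" for a b
    by (metis dot_lmul_matrix inner_commute transpose_matrix_vector)
  then show ?thesis by (simp add: laplacian_sym_mult inner_add_right del: transpose_matrix_vector)
qed

lemma laplacian_sym_form: "y \<bullet> (laplacian_sym A *v y) = y \<bullet> (laplacian A *v y)"
proof -
  have "y \<bullet> (transpose (laplacian A) *v y) = y \<bullet> (laplacian A *v y)"
    by (metis dot_lmul_matrix inner_commute transpose_matrix_vector)
  then show ?thesis by (simp add: laplacian_sym_mult inner_add_right)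
qed

lemma one_inner_laplacian_sym:
  assumes "weight_balanced A"
  shows "1 \<bullet> (laplacian_sym A *v y) = 0"
proof -
  have "1 \<bullet> (transpose (laplacian A) *v y) = y \<bullet> (laplacian A *v 1)"
    by (metis dot_lmul_matrix inner_commute transpose_matrix_vector)
  then show ?thesis
    using one_inner_laplacian[OF assms] by (simp add: laplacian_sym_mult inner_add_right laplacian_mult_one)
qed

lemma linear_term_zero:
  fixes b c :: real
  assumes "\<And>e. 2 * e * b + e\<^sup>2 * c \<ge> 0"
  shows "b = 0"
proof (rule ccontr)
  assume b: "b \<noteq> 0"
  \<comment> \<open>at \<open>e = - b / d\<close> with \<open>d > c\<close> the linear term dominates the quadratic one\<close>
  define d where "d = \<bar>c\<bar> + 1"
  have d: "d > 0" "c < d" unfolding d_def by auto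
  have "2 * (- b / d) * b + (- b / d)\<^sup>2 * c = (b\<^sup>2 / d) * (c / d - 2)"
    using d by (simp add: field_simps power2_eq_square)
  moreover have "(b\<^sup>2 / d) * (c / d - 2) < 0"
    by (rule mult_pos_neg) (use b d in \<open>auto simp: field_simps\<close>)
  ultimately have "2 * (- b / d) * b + (- b / d)\<^sup>2 * c < 0" by linarith
  then show False using assms[of "- b / d"] by linarith
qed

text \<open>The variational characterisation of eigenvalues: at a minimiser \<open>w\<close> of the Rayleigh quotient the
  form \<open>y \<bullet> f y - l * (norm y)\<^sup>2\<close> attains its minimum zero, so its derivative in the direction of the
  residual \<open>h = f w - l w\<close> vanishes. That derivative is twice the squared norm of \<open>h\<close>.\<close>

lemma self_adjoint_minimizer_eigenvector:
  fixes f :: "'a::real_inner \<Rightarrow> 'a"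
  assumes lin: "linear f" and sa: "\<And>x y. x \<bullet> f y = y \<bullet> f x"
    and H: "subspace H" and fH: "\<And>y. y \<in> H \<Longrightarrow> f y \<in> H"
    and min: "\<And>y. y \<in> H \<Longrightarrow> l * (norm y)\<^sup>2 \<le> y \<bullet> f y"
    and w: "w \<in> H" "w \<bullet> f w = l * (norm w)\<^sup>2"
  shows "f w = l *\<^sub>R w"
proof -
  define h where "h = f w - l *\<^sub>R w"
  have hH: "h \<in> H" unfolding h_def using H w fH by (simp add: subspace_diff subspace_scale)
  have "2 * e * (h \<bullet> h) + e\<^sup>2 * (h \<bullet> f h - l * (h \<bullet> h)) \<ge> 0" for e
  proof -
    have "w + e *\<^sub>R h \<in> H" using H w hH by (simp add: subspace_add subspace_scale)
    from min[OF this] have le: "l * ((w + e *\<^sub>R h) \<bullet> (w + e *\<^sub>R h)) \<le> (w + e *\<^sub>R h) \<bullet> f (w + e *\<^sub>R h)"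
      by (simp add: power2_norm_eq_inner)
    have form: "(w + e *\<^sub>R h) \<bullet> f (w + e *\<^sub>R h) =
        w \<bullet> f w + 2 * e * (h \<bullet> f w) + e\<^sup>2 * (h \<bullet> f h)"
      using sa[of w h] by (simp add: linear_add[OF lin] linear_scale[OF lin] inner_add_left
          inner_add_right power2_eq_square algebra_simps)
    have norm: "(w + e *\<^sub>R h) \<bullet> (w + e *\<^sub>R h) = w \<bullet> w + 2 * e * (h \<bullet> w) + e\<^sup>2 * (h \<bullet> h)"
      by (simp add: inner_add_left inner_add_right power2_eq_square inner_commute)
    have "h \<bullet> f w = h \<bullet> h + l * (h \<bullet> w)"
      by (subst (3) h_def) (simp add: inner_diff_right)
    then have lin_term: "2 * e * (h \<bullet> h) = 2 * e * (h \<bullet> f w) - l * (2 * e * (h \<bullet> w))"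
      by (simp add: algebra_simps)
    have "w \<bullet> f w = l * (w \<bullet> w)" using w(2) by (simp add: power2_norm_eq_inner)
    then show ?thesis
      using le lin_term unfolding form norm by (simp add: distrib_left right_diff_distrib mult.left_commute)
  qed
  then have "h \<bullet> h = 0" by (rule linear_term_zero)
  then show ?thesis unfolding h_def by simp
qed

text \<open>The Rayleigh quotient attains its minimum \<open>l\<close> over the unit vectors of mean zero by compactness.
  This \<open>l\<close> is positive, is an eigenvalue, and lies below every other nonzero eigenvalue, so it is
  \<open>lambda2_hat A\<close>. This settles at once that the least nonzero eigenvalue exists and that it bounds
  the form from below.\<close>

lemma lambda2_hat_gap:
  fixes A :: "real^'n::finite^'n"
  assumes card: "CARD('n) \<ge> 2" and E: "weighted_digraph E A"
    and conn: "strongly_connected_digraph E" and bal: "weight_balanced A"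
  shows "lambda2_hat A > 0"
    and "1 \<bullet> y = 0 \<Longrightarrow> lambda2_hat A * (norm y)\<^sup>2 \<le> y \<bullet> (laplacian A *v y)"
proof -
  let ?M = "laplacian_sym A"
  define H :: "(real^'n) set" where "H = {y. 1 \<bullet> y = 0}"
  define K where "K = H \<inter> sphere 0 1"
  have H: "subspace H" unfolding H_def by (rule subspace_hyperplane)
  have "closed H" unfolding H_def by (rule closed_hyperplane)
  then have K: "compact K" unfolding K_def by (simp add: closed_Int_compact)
  \<comment> \<open>two distinct nodes provide a nonzero vector of mean zero, so the constraint set is nonempty\<close>
  obtain i j :: 'n where ij: "i \<noteq> j"
    using card by (metis (full_types) One_nat_def card_2_iff' ex_card iso_tuple_UNIV_I)
  define d :: "real^'n" where "d = axis i 1 - axis j 1"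
  have dH: "d \<in> H" unfolding H_def d_def by (simp add: inner_diff_right inner_axis)
  have dnz: "d \<noteq> 0"
  proof
    assume "d = 0"
    then have "d $ i = 0" by simp
    then show False using ij by (simp add: d_def axis_def)
  qed
  have "(1 / norm d) *\<^sub>R d \<in> K"
    using dH dnz H by (simp add: K_def subspace_scale)
  then have Kne: "K \<noteq> {}" by blast
  have cont: "continuous_on K (\<lambda>y. y \<bullet> (?M *v y))"
    by (intro continuous_intros linear_continuous_on_compose[where f="\<lambda>y. y"]
        matrix_vector_mul_linear)
  obtain w where w: "w \<in> K" and wmin: "\<And>y. y \<in> K \<Longrightarrow> w \<bullet> (?M *v w) \<le> y \<bullet> (?M *v y)"
    using continuous_attains_inf[OF K Kne cont] by blast
  define l where "l = w \<bullet> (?M *v w)"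
  have wH: "w \<in> H" and nw: "norm w = 1" using w by (auto simp: K_def)
  have wnz: "w \<noteq> 0" using nw by auto
  have lpos: "l > 0"
    using laplacian_form_pos[OF E conn bal, of w] wH wnz
    by (simp add: l_def laplacian_sym_form H_def)
  have gap: "l * (norm y)\<^sup>2 \<le> y \<bullet> (?M *v y)" if "y \<in> H" for y
  proof (cases "y = 0")
    case False
    have "(1 / norm y) *\<^sub>R y \<in> K"
      using that False H by (simp add: K_def subspace_scale)
    from wmin[OF this] show ?thesis
      using False by (simp add: l_def matrix_vector_mult_scaleR field_simps power2_eq_square)
  qed simp
  have "?M *v w = l *\<^sub>R w"
  proof (rule self_adjoint_minimizer_eigenvector[where H = H])
    show "linear ((*v) ?M)" by (rule matrix_vector_mul_linear)
    show "?M *v y \<in> H" for y using one_inner_laplacian_sym[OF bal] by (simp add: H_def)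
    show "w \<bullet> (?M *v w) = l * (norm w)\<^sup>2" by (simp add: nw l_def)
  qed (use H gap wH laplacian_sym_self_adjoint in auto)
  then have ev: "real_eigenvalue ?M l" using wnz unfolding real_eigenvalue_def by blast
  have least: "l \<le> m" if m: "m \<noteq> 0" "real_eigenvalue ?M m" for m
  proof -
    obtain z where z: "z \<noteq> 0" "?M *v z = m *\<^sub>R z" using m(2) unfolding real_eigenvalue_def by blast
    \<comment> \<open>the range of the symmetrised Laplacian is orthogonal to the constant vectors, hence so is
      every eigenvector with a nonzero eigenvalue\<close>
    have "m * (1 \<bullet> z) = 0" using one_inner_laplacian_sym[OF bal, of z] z by simp
    then have "z \<in> H" using m by (simp add: H_def)
    from gap[OF this] have "l * (norm z)\<^sup>2 \<le> m * (norm z)\<^sup>2"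
      using z by (simp add: power2_norm_eq_inner)
    then show ?thesis using z by simp
  qed
  have l: "lambda2_hat A = l"
    unfolding lambda2_hat_def laplacian_sym_def[symmetric]
    by (rule Least_equality) (use lpos ev least in auto)
  show "lambda2_hat A > 0" using lpos l by simp
  show "lambda2_hat A * (norm y)\<^sup>2 \<le> y \<bullet> (laplacian A *v y)" if "1 \<bullet> y = 0"
    using gap[of y] that by (simp add: l H_def laplacian_sym_form)
qed

section \<open>Removal of the mean\<close>

lemma Pi_matrix_mult:
  "Pi_matrix *v y = y - ((1 \<bullet> y) / real CARD('n)) *\<^sub>R (1::real^'n::finite)"
proof -
  have "((\<chi> i j. 1) *v y) = (1 \<bullet> y) *\<^sub>R (1::real^'n)"
    by (simp add: vec_eq_iff matrix_vector_mult_def inner_one_vec)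
  then show ?thesis
    by (simp add: Pi_matrix_def matrix_vector_mult_diff_rdistrib
        scaleR_matrix_vector_assoc[symmetric])
qed

lemma one_inner_Pi: "1 \<bullet> (Pi_matrix *v y) = 0" for y :: "real^'n::finite"
  by (simp add: Pi_matrix_mult inner_diff_right inner_one_vec)

text \<open>\<open>Pi_matrix\<close> is an orthogonal projection, so it may be dropped next to a vector in its range.\<close>

lemma Pi_inner: "(Pi_matrix *v y) \<bullet> (Pi_matrix *v z) = (Pi_matrix *v y) \<bullet> z" for y z :: "real^'n::finite"
proof -
  have "(Pi_matrix *v y) \<bullet> 1 = 0" using one_inner_Pi[of y] by (simp add: inner_commute)
  then show ?thesis by (subst (2) Pi_matrix_mult) (simp add: inner_diff_right)
qed

lemma laplacian_mult_Pi: "laplacian A *v (Pi_matrix *v y) = laplacian A *v y" for y :: "real^'n::finite"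
  by (simp add: Pi_matrix_mult matrix_vector_mult_diff_distrib matrix_vector_mult_scaleR laplacian_mult_one)

lemma abs_mean_le_norm:
  fixes s :: "real^'n::finite"
  shows "\<bar>1 \<bullet> s / real CARD('n)\<bar> \<le> norm s"
proof -
  have "\<bar>1 \<bullet> s\<bar> \<le> (\<Sum>i\<in>(UNIV::'n set). norm s)"
    unfolding inner_one_vec by (rule order_trans[OF sum_abs sum_mono]) (rule component_le_norm_cart)
  then show ?thesis by (simp add: field_simps)
qed

section \<open>Differential inequalities off a locally finite set\<close>

lemma open_pos_Diff_locally_finite:
  assumes "locally_finite_times S"
  shows "open ({0<..} - S)"
proof (subst open_subopen, rule ballI)
  fix t assume t: "t \<in> {0<..} - S"
  have "open ({0<..<t+1} - (S \<inter> {0..t+1}))"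
    using assms by (intro open_Diff finite_imp_closed) (auto simp: locally_finite_times_def)
  moreover have "{0<..<t+1} - (S \<inter> {0..t+1}) \<subseteq> {0<..} - S" by auto
  ultimately show "\<exists>T. open T \<and> t \<in> T \<and> T \<subseteq> {0<..} - S"
    using t by (intro exI[of _ "{0<..<t+1} - (S \<inter> {0..t+1})"]) auto
qed

lemma locally_finite_times_Un:
  "locally_finite_times S \<Longrightarrow> locally_finite_times T \<Longrightarrow> locally_finite_times (S \<union> T)"
  by (simp add: locally_finite_times_def Int_Un_distrib2)

lemma locally_finite_times_UN:
  "finite I \<Longrightarrow> (\<And>i. i \<in> I \<Longrightarrow> locally_finite_times (S i)) \<Longrightarrow> locally_finite_times (\<Union>i\<in>I. S i)"
  by (simp add: locally_finite_times_def UN_extend_simps del: UN_simps)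

text \<open>Continuity bridges the exceptional times: the fundamental theorem of calculus holds with finitely
  many exceptions, and only finitely many of them lie between \<open>a\<close> and \<open>b\<close>.\<close>

lemma nonincreasing_off_locally_finite:
  fixes g :: "real \<Rightarrow> real"
  assumes S: "locally_finite_times S" and cont: "continuous_on {0..} g" and a: "0 \<le> a" "a \<le> b"
    and d: "\<And>t. t > a \<Longrightarrow> t \<notin> S \<Longrightarrow> \<exists>d\<le>0. (g has_real_derivative d) (at t)"
  shows "g b \<le> g a"
proof -
  from d obtain g' where g': "\<And>t. t > a \<Longrightarrow> t \<notin> S \<Longrightarrow> g' t \<le> 0 \<and> (g has_real_derivative g' t) (at t)"
    by metis
  define k where "k t = (if t > a \<and> t \<notin> S then g' t else 0)" for t
  have "(k has_integral (g b - g a)) {a..b}"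
  proof (rule fundamental_theorem_of_calculus_interior_strong[where S = "S \<inter> {0..b}"])
    show "finite (S \<inter> {0..b})" using S by (simp add: locally_finite_times_def)
    show "continuous_on {a..b} g" using cont by (rule continuous_on_subset) (use a in auto)
    show "(g has_vector_derivative k t) (at t)" if "t \<in> {a<..<b} - S \<inter> {0..b}" for t
      using that a g'[of t] by (auto simp: k_def has_real_derivative_iff_has_vector_derivative)
  qed (use a in auto)
  then have "g b - g a \<le> 0"
    by (rule has_integral_le[OF _ has_integral_0]) (use g' in \<open>auto simp: k_def\<close>)
  then show ?thesis by simp
qed

text \<open>Gronwall's inequality in its linear form. The integrating factor \<open>exp (\<mu> * (t - a))\<close> turns the
  excess of \<open>W\<close> over the equilibrium \<open>C / \<mu>\<close> into a nonincreasing function.\<close>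

lemma exponential_decay_off_locally_finite:
  fixes W :: "real \<Rightarrow> real"
  assumes S: "locally_finite_times S" and cont: "continuous_on {0..} W" and a: "0 \<le> a" "a \<le> t"
    and \<mu>: "\<mu> > 0"
    and d: "\<And>t. t > a \<Longrightarrow> t \<notin> S \<Longrightarrow> \<exists>d\<le> C - \<mu> * W t. (W has_real_derivative d) (at t)"
  shows "W t \<le> C / \<mu> + exp (- (\<mu> * (t - a))) * (W a - C / \<mu>)"
proof -
  define g where "g t = exp (\<mu> * (t - a)) * (W t - C / \<mu>)" for t
  have "g t \<le> g a"
  proof (rule nonincreasing_off_locally_finite[OF S _ a])
    show "continuous_on {0..} g" unfolding g_def by (intro continuous_intros cont)
    fix r assume "r > a" "r \<notin> S"
    then obtain d' where d': "d' \<le> C - \<mu> * W r" "(W has_real_derivative d') (at r)" using d by blast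
    have "(g has_real_derivative exp (\<mu> * (r - a)) * (\<mu> * W r - C + d')) (at r)"
      unfolding g_def using \<mu>
      by (auto intro!: derivative_eq_intros d'(2) simp: algebra_simps)
    moreover have "exp (\<mu> * (r - a)) * (\<mu> * W r - C + d') \<le> 0"
      using d'(1) by (simp add: mult_le_0_iff)
    ultimately show "\<exists>d\<le>0. (g has_real_derivative d) (at r)" by blast
  qed
  then have "exp (\<mu> * (t - a)) * (W t - C / \<mu>) \<le> W a - C / \<mu>" by (simp add: g_def)
  then have "exp (- (\<mu> * (t - a))) * (exp (\<mu> * (t - a)) * (W t - C / \<mu>))
      \<le> exp (- (\<mu> * (t - a))) * (W a - C / \<mu>)"
    by (intro mult_left_mono) auto
  then show ?thesis by (simp add: mult.assoc[symmetric] exp_add[symmetric])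
qed

lemma eventually_exp_decay_less:
  fixes \<mu> a K e :: real
  assumes "\<mu> > 0" "e > 0"
  shows "eventually (\<lambda>t. exp (- (\<mu> * (t - a))) * K < e) at_top"
proof -
  have "filterlim (\<lambda>t::real. t - a) at_top at_top"
    using filterlim_tendsto_add_at_top[OF tendsto_const[of "-a"] filterlim_ident] by simp
  then have "filterlim (\<lambda>t. \<mu> * (t - a)) at_top at_top"
    by (rule filterlim_tendsto_pos_mult_at_top[OF tendsto_const assms(1)])
  then have "filterlim (\<lambda>t. - (\<mu> * (t - a))) at_bot at_top"
    by (simp add: filterlim_uminus_at_top)
  then have "((\<lambda>t. exp (- (\<mu> * (t - a)))) \<longlongrightarrow> 0) at_top"
    by (rule filterlim_compose[OF exp_at_bot])
  then have "((\<lambda>t. exp (- (\<mu> * (t - a))) * K) \<longlongrightarrow> 0 * K) at_top"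
    by (intro tendsto_intros)
  then show ?thesis using order_tendstoD(2)[of _ 0] assms by auto
qed

lemma inner_self_has_real_derivative:
  fixes f :: "real \<Rightarrow> 'a::real_inner"
  assumes "(f has_vector_derivative f') (at t)"
  shows "((\<lambda>t. f t \<bullet> f t) has_real_derivative 2 * (f t \<bullet> f')) (at t)"
  using bounded_bilinear.has_vector_derivative[OF bounded_bilinear_inner assms assms]
  by (simp add: has_real_derivative_iff_has_vector_derivative inner_commute)

section \<open>The disagreement dynamics\<close>

text \<open>The Lyapunov argument: \<open>s\<close> decays, and the squared norm of the disagreement \<open>p\<close> dissipates at rate
  \<open>\<mu> = \<beta> * l\<close> up to the input rate. A strict bound by every \<open>c\<close> above the claimed limit, rather than
  the upper limit itself, keeps the estimate within the reals.\<close>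

lemma consensus_error_eventually_less:
  fixes A :: "real^'n::finite^'n" and u x v :: "real \<Rightarrow> real^'n"
  assumes gap: "\<And>y. 1 \<bullet> y = 0 \<Longrightarrow> l * (norm y)\<^sup>2 \<le> y \<bullet> (laplacian A *v y)" and l: "l > 0"
    and bal: "weight_balanced A" and S: "locally_finite_times S"
    and \<alpha>: "\<alpha> > 0" and \<beta>: "\<beta> > 0" and \<gamma>: "\<gamma> \<ge> 0"
    and cont: "continuous_on {0..} u" "continuous_on {0..} x" "continuous_on {0..} v"
    and du: "\<And>t. t > 0 \<Longrightarrow> t \<notin> S \<Longrightarrow> (u has_vector_derivative u' t) (at t)"
    and dx: "\<And>t. t > 0 \<Longrightarrow> t \<notin> S \<Longrightarrow> (x has_vector_derivative
        u' t - \<alpha> *\<^sub>R (x t - u t) - \<beta> *\<^sub>R (laplacian A *v x t) - v t) (at t)"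
    and dv: "\<And>t. t > 0 \<Longrightarrow> t \<notin> S \<Longrightarrow> (v has_vector_derivative
        (\<alpha> * \<beta>) *\<^sub>R (laplacian A *v x t)) (at t)"
    and bound: "\<And>t. t > 0 \<Longrightarrow> t \<notin> S \<Longrightarrow> norm (Pi_matrix *v u' t) \<le> \<gamma>"
    and v0: "1 \<bullet> v 0 = 0" and c: "c > \<gamma> / (\<beta> * l)"
  shows "eventually (\<lambda>t. \<bar>x t $ i - (1 \<bullet> u t) / real CARD('n)\<bar> < c) at_top"
proof -
  define \<mu> where "\<mu> = \<beta> * l"
  have \<mu>: "\<mu> > 0" using \<beta> l by (simp add: \<mu>_def)
  \<comment> \<open>the combination in which the Laplacian terms of \<open>x\<close> and \<open>v\<close> cancel\<close>
  define s where "s t = x t - u t + (1/\<alpha>) *\<^sub>R v t" for t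
  define p where "p t = Pi_matrix *v x t" for t
  have lin: "bounded_linear ((*v) (Pi_matrix :: real^'n^'n))" by simp

  have ds: "(s has_vector_derivative - \<alpha> *\<^sub>R s t) (at t)" if t: "t > 0" "t \<notin> S" for t
  proof -
    have "(s has_vector_derivative (u' t - \<alpha> *\<^sub>R (x t - u t) - \<beta> *\<^sub>R (laplacian A *v x t) - v t)
        - u' t + (1/\<alpha>) *\<^sub>R ((\<alpha> * \<beta>) *\<^sub>R (laplacian A *v x t))) (at t)"
      unfolding s_def
      by (intro has_vector_derivative_add has_vector_derivative_diff dx du t
          bounded_linear.has_vector_derivative[OF bounded_linear_scaleR_right] dv)
    moreover have "(u' t - \<alpha> *\<^sub>R (x t - u t) - \<beta> *\<^sub>R (laplacian A *v x t) - v t)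
        - u' t + (1/\<alpha>) *\<^sub>R ((\<alpha> * \<beta>) *\<^sub>R (laplacian A *v x t)) = - \<alpha> *\<^sub>R s t"
      using \<alpha> by (simp add: s_def scaleR_right_distrib)
    ultimately show ?thesis by simp
  qed
  have s_decay: "s t \<bullet> s t \<le> exp (- (2 * \<alpha> * (t - 0))) * (s 0 \<bullet> s 0)" if "t \<ge> 0" for t
  proof -
    have "s t \<bullet> s t \<le> 0 / (2 * \<alpha>) + exp (- (2 * \<alpha> * (t - 0))) * (s 0 \<bullet> s 0 - 0 / (2 * \<alpha>))"
    proof (rule exponential_decay_off_locally_finite[OF S _ _ that])
      show "continuous_on {0..} (\<lambda>t. s t \<bullet> s t)"
        unfolding s_def by (intro continuous_intros cont)
      show "\<exists>d\<le>0 - 2 * \<alpha> * (s t \<bullet> s t). ((\<lambda>t. s t \<bullet> s t) has_real_derivative d) (at t)"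
        if "t > 0" "t \<notin> S" for t
        using inner_self_has_real_derivative[OF ds[OF that]] by (intro exI) (auto simp: mult.assoc)
    qed (use \<alpha> in auto)
    then show ?thesis by simp
  qed
  have s_small: "eventually (\<lambda>t. norm (s t) < e) at_top" if "e > 0" for e
  proof -
    have "eventually (\<lambda>t. exp (- (2 * \<alpha> * (t - 0))) * (s 0 \<bullet> s 0) < e\<^sup>2) at_top"
      using \<alpha> that by (intro eventually_exp_decay_less) auto
    then show ?thesis
      using eventually_ge_at_top[of 0]
    proof eventually_elim
      case (elim t)
      then have "(norm (s t))\<^sup>2 < e\<^sup>2"
        using s_decay[of t] by (simp add: power2_norm_eq_inner)
      then show ?case using that by (simp add: power2_less_imp_less)
    qed
  qed

  have v_mean: "1 \<bullet> v t = 0" if "t \<ge> 0" for t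
  proof -
    have "(1 \<bullet> v t) \<bullet> (1 \<bullet> v t) \<le> (1 \<bullet> v 0) \<bullet> (1 \<bullet> v 0)"
    proof (rule nonincreasing_off_locally_finite[OF S _ _ that])
      show "continuous_on {0..} (\<lambda>t. (1 \<bullet> v t) \<bullet> (1 \<bullet> v t))" by (intro continuous_intros cont)
      fix t assume t: "t > 0" "t \<notin> S"
      have "((\<lambda>t. 1 \<bullet> v t) has_vector_derivative 1 \<bullet> ((\<alpha> * \<beta>) *\<^sub>R (laplacian A *v x t))) (at t)"
        by (rule bounded_linear.has_vector_derivative[OF bounded_linear_inner_right dv[OF t]])
      then have "((\<lambda>t. 1 \<bullet> v t) has_vector_derivative 0) (at t)"
        by (simp add: one_inner_laplacian[OF bal])
      from inner_self_has_real_derivative[OF this]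
      show "\<exists>d\<le>0. ((\<lambda>t. (1 \<bullet> v t) \<bullet> (1 \<bullet> v t)) has_real_derivative d) (at t)"
        by (intro exI) auto
    qed auto
    then have "(1 \<bullet> v t)\<^sup>2 \<le> 0" using v0 by (simp add: power2_eq_square)
    then show ?thesis by simp
  qed

  have dp: "\<exists>d\<le>(\<gamma> + \<alpha> * norm (s t))\<^sup>2 / \<mu> - \<mu> * (p t \<bullet> p t).
      ((\<lambda>t. p t \<bullet> p t) has_real_derivative d) (at t)" if t: "t > 0" "t \<notin> S" for t
  proof -
    define w where "w = u' t - \<beta> *\<^sub>R (laplacian A *v x t) - \<alpha> *\<^sub>R s t"
    have "u' t - \<alpha> *\<^sub>R (x t - u t) - \<beta> *\<^sub>R (laplacian A *v x t) - v t = w"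
      using \<alpha> by (simp add: w_def s_def scaleR_right_distrib)
    then have "(p has_vector_derivative Pi_matrix *v w) (at t)"
      unfolding p_def using bounded_linear.has_vector_derivative[OF lin dx[OF t]] by simp
    from inner_self_has_real_derivative[OF this]
    have D: "((\<lambda>t. p t \<bullet> p t) has_real_derivative 2 * (p t \<bullet> w)) (at t)"
      unfolding p_def Pi_inner .
    \<comment> \<open>size of the total disturbance that acts on the disagreement\<close>
    define b where "b = \<gamma> + \<alpha> * norm (s t)"
    have "p t \<bullet> u' t = p t \<bullet> (Pi_matrix *v u' t)" by (simp add: p_def Pi_inner)
    also have "\<dots> \<le> norm (p t) * \<gamma>"
      by (rule order_trans[OF norm_cauchy_schwarz mult_left_mono]) (use bound t in auto)
    finally have 1: "p t \<bullet> u' t \<le> norm (p t) * \<gamma>" .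
    have "- (p t \<bullet> s t) \<le> norm (p t) * norm (s t)"
      using norm_cauchy_schwarz[of "p t" "- s t"] by simp
    then have 2: "- (\<alpha> * (p t \<bullet> s t)) \<le> \<alpha> * (norm (p t) * norm (s t))"
      using mult_left_mono[of "- (p t \<bullet> s t)" _ \<alpha>] \<alpha> by simp
    have "l * (norm (p t))\<^sup>2 \<le> p t \<bullet> (laplacian A *v x t)"
      using gap[of "p t"] by (simp add: p_def one_inner_Pi laplacian_mult_Pi)
    then have 3: "\<mu> * (norm (p t))\<^sup>2 \<le> \<beta> * (p t \<bullet> (laplacian A *v x t))"
      using \<beta> by (simp add: \<mu>_def mult.assoc)
    have "p t \<bullet> w \<le> norm (p t) * b - \<mu> * (norm (p t))\<^sup>2"
      using 1 2 3 by (simp add: w_def inner_diff_right b_def distrib_left algebra_simps)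
    moreover have "2 * norm (p t) * b \<le> b\<^sup>2 / \<mu> + \<mu> * (norm (p t))\<^sup>2"
    proof -
      \<comment> \<open>Young's inequality, with the weight for which equality holds at \<open>norm (p t) = b / \<mu>\<close>\<close>
      have "0 \<le> (b - \<mu> * norm (p t))\<^sup>2 / \<mu>" using \<mu> by simp
      also have "\<dots> = b\<^sup>2 / \<mu> + \<mu> * (norm (p t))\<^sup>2 - 2 * norm (p t) * b"
        using \<mu> by (simp add: power2_eq_square field_simps)
      finally show ?thesis by simp
    qed
    ultimately have "2 * (p t \<bullet> w) \<le> b\<^sup>2 / \<mu> - \<mu> * (p t \<bullet> p t)"
      by (simp add: power2_norm_eq_inner)
    then show ?thesis using D by (auto simp: b_def)
  qed

  \<comment> \<open>The margin between \<open>c\<close> and \<open>\<gamma> / \<mu>\<close> is split in three: for the effect of \<open>s\<close> on the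
    equilibrium, for the transient of \<open>p\<close>, and for the mean of \<open>s\<close>.\<close>
  define \<eta> where "\<eta> = (c - \<gamma> / \<mu>) / 3"
  have \<eta>: "\<eta> > 0" using c by (simp add: \<eta>_def \<mu>_def)
  define q where "q = \<gamma> / \<mu> + \<eta>"
  have q: "q > 0" using \<gamma> \<mu> \<eta> by (simp add: q_def add_nonneg_pos)
  have "eventually (\<lambda>t. norm (s t) < min \<eta> (\<mu> * \<eta> / \<alpha>)) at_top"
    using \<eta> \<mu> \<alpha> by (intro s_small) auto
  then obtain T0 where T0: "\<And>t. t \<ge> T0 \<Longrightarrow> norm (s t) < min \<eta> (\<mu> * \<eta> / \<alpha>)"
    unfolding eventually_at_top_linorder by blast
  define T where "T = max T0 0"
  have T: "T \<ge> 0" "\<And>t. t \<ge> T \<Longrightarrow> norm (s t) < \<eta>" "\<And>t. t \<ge> T \<Longrightarrow> \<alpha> * norm (s t) \<le> \<mu> * \<eta>"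
    using T0 \<alpha> by (force simp: T_def field_simps)+
  have W: "p t \<bullet> p t \<le> q\<^sup>2 + exp (- (\<mu> * (t - T))) * (p T \<bullet> p T - q\<^sup>2)" if "t \<ge> T" for t
  proof -
    have "p t \<bullet> p t \<le> (\<mu> * q\<^sup>2) / \<mu> + exp (- (\<mu> * (t - T))) * (p T \<bullet> p T - (\<mu> * q\<^sup>2) / \<mu>)"
    proof (rule exponential_decay_off_locally_finite[OF S _ T(1) that \<mu>])
      show "continuous_on {0..} (\<lambda>t. p t \<bullet> p t)"
        unfolding p_def
        by (intro continuous_intros bounded_linear.continuous_on[OF lin] cont)
      fix t assume t: "t > T" "t \<notin> S"
      have "(\<gamma> + \<alpha> * norm (s t))\<^sup>2 / \<mu> \<le> (\<gamma> + \<mu> * \<eta>)\<^sup>2 / \<mu>"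
        using T(3)[of t] t \<mu> \<gamma> \<alpha> by (intro divide_right_mono power_mono) auto
      also have "\<dots> = \<mu> * q\<^sup>2" using \<mu> by (simp add: q_def power2_eq_square field_simps)
      finally show "\<exists>d\<le>\<mu> * q\<^sup>2 - \<mu> * (p t \<bullet> p t). ((\<lambda>t. p t \<bullet> p t) has_real_derivative d) (at t)"
        using dp[of t] t T(1) by (meson diff_right_mono le_less_trans order_trans)
    qed
    then show ?thesis using \<mu> by simp
  qed
  have "(q + \<eta>)\<^sup>2 - q\<^sup>2 > 0"
    using q \<eta> by (simp add: power2_eq_square algebra_simps add_pos_pos)
  from eventually_exp_decay_less[OF \<mu> this, of T "p T \<bullet> p T - q\<^sup>2"] eventually_ge_at_top[of T]
  show ?thesis
  proof eventually_elim
    case (elim t)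
    then have "(norm (p t))\<^sup>2 < (q + \<eta>)\<^sup>2" using W[of t] by (simp add: power2_norm_eq_inner)
    then have "norm (p t) < q + \<eta>" by (rule power2_less_imp_less) (use q \<eta> in simp)
    moreover have "norm (s t) < \<eta>" using T elim by simp
    moreover have "x t $ i - (1 \<bullet> u t) / real CARD('n) = p t $ i + 1 \<bullet> s t / real CARD('n)"
      using v_mean[of t] elim T(1)
      by (simp add: p_def s_def Pi_matrix_mult inner_add_right inner_diff_right diff_divide_distrib)
    moreover have "\<bar>p t $ i\<bar> \<le> norm (p t)" by (rule component_le_norm_cart)
    moreover have "\<bar>1 \<bullet> s t / real CARD('n)\<bar> \<le> norm (s t)" by (rule abs_mean_le_norm)
    ultimately have "\<bar>x t $ i - (1 \<bullet> u t) / real CARD('n)\<bar> < q + \<eta> + \<eta>" by linarith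
    also have "q + \<eta> + \<eta> = c" by (simp add: q_def \<eta>_def field_simps)
    finally show ?case .
  qed
qed

section \<open>Derivatives of piecewise smooth signals\<close>

text \<open>The complement of \<open>S\<close> in the positive times is open and \<open>g\<close> is continuous there, so the bound would
  fail on a nonempty open set, which has positive measure, if it failed at one point.\<close>

lemma ess_norm_pointwise_bound:
  fixes g :: "real \<Rightarrow> 'a::real_normed_vector"
  assumes ess: "ess_norm g = ereal \<gamma>" and S: "locally_finite_times S"
    and cont: "continuous_on ({0..} - S) g" and t: "t > 0" "t \<notin> S"
  shows "norm (g t) \<le> \<gamma>"
proof (rule ccontr)
  assume "\<not> norm (g t) \<le> \<gamma>"
  define U where "U = {0<..} - S"
  have U: "open U" unfolding U_def by (rule open_pos_Diff_locally_finite[OF S])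
  have "continuous_on U (\<lambda>t. norm (g t))"
    by (intro continuous_on_norm continuous_on_subset[OF cont]) (auto simp: U_def)
  then have "open (U \<inter> (\<lambda>t. norm (g t)) -` {\<gamma><..})"
    by (rule continuous_open_preimage) (auto simp: U)
  then have closed: "closed (- (U \<inter> (\<lambda>t. norm (g t)) -` {\<gamma><..}))" by (rule closed_Compl)
  have "AE t in lebesgue_on {0..}. ereal (norm (g t)) \<le> ereal \<gamma>"
    using esssup_AE[of "\<lambda>t. ereal (norm (g t))" "lebesgue_on {0..}"] ess by (simp add: ess_norm_def)
  then have "AE t in lebesgue. t \<in> {0..} \<longrightarrow> norm (g t) \<le> \<gamma>"
    by (subst (asm) AE_restrict_space_iff) auto
  then have "AE t in lebesgue. t \<in> U \<longrightarrow> t \<in> - (U \<inter> (\<lambda>t. norm (g t)) -` {\<gamma><..})"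
    by (rule AE_mp) (auto simp: U_def)
  from mem_closed_if_AE_lebesgue_open[OF U closed this, of t]
  show False using t \<open>\<not> norm (g t) \<le> \<gamma>\<close> by (auto simp: U_def)
qed

lemma has_vector_derivative_vecI:
  fixes f :: "real \<Rightarrow> real^'n::finite"
  assumes "\<And>i. ((\<lambda>s. f s $ i) has_real_derivative f' $ i) (at t)"
  shows "(f has_vector_derivative f') (at t)"
  unfolding has_vector_derivative_def
proof (subst has_derivative_componentwise_within, rule ballI)
  fix b :: "real^'n" assume "b \<in> Basis"
  then obtain i where "b = axis i 1" by (auto simp: Basis_vec_def)
  then show "((\<lambda>s. f s \<bullet> b) has_derivative (\<lambda>s. (s *\<^sub>R f') \<bullet> b)) (at t)"
    using assms[of i]
    by (simp add: inner_axis has_real_derivative_iff_has_vector_derivative has_vector_derivative_def)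
qed

lemma time_deriv_eqI:
  assumes "t > 0" "(f has_vector_derivative f') (at t within {0..})"
  shows "time_deriv f t = f'"
proof -
  have "at t within {0..} = at t" using assms(1) by (intro at_within_interior) simp
  then show ?thesis
    unfolding time_deriv_def using assms(2) by (simp add: vector_derivative_at)
qed

section \<open>Tracking of the average input\<close>

theorem corollary4p1:
  fixes E :: "('n::finite \<times> 'n) set"
    and A :: "real ^ 'n ^ 'n"
    and u x v :: "real \<Rightarrow> real ^ 'n"
    and \<alpha> \<beta> \<gamma> :: real
  assumes "CARD('n) \<ge> 2"
    and "weighted_digraph E A"
    and "strongly_connected_digraph E"
    and "weight_balanced A"
    and "\<And>i. piecewise_cont_differentiable (\<lambda>t. u t $ i)"
    and "ess_norm (\<lambda>t. Pi_matrix *v time_deriv u t) = ereal \<gamma>"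
    and "\<alpha> > 0" and "\<beta> > 0"
    and "consensus_trajectory (laplacian A) \<alpha> \<beta> u x v"
    and "(\<Sum>i\<in>UNIV. v 0 $ i) = 0"
  shows "\<forall>i. Limsup at_top (\<lambda>t. ereal \<bar>x t $ i - (1 / real CARD('n)) * (\<Sum>j\<in>UNIV. u t $ j)\<bar>)
               \<le> ereal (inverse (\<beta> * lambda2_hat A) * \<gamma>)"
proof -
  have "\<forall>i. \<exists>S. locally_finite_times S \<and>
      (\<forall>t\<in>{0..} - S. (\<lambda>t. u t $ i) differentiable (at t within {0..}))"
    using assms(5) unfolding piecewise_cont_differentiable_def by blast
  then obtain Sd where Sd: "\<And>i. locally_finite_times (Sd i)"
      "\<And>i t. t \<in> {0..} - Sd i \<Longrightarrow> (\<lambda>t. u t $ i) differentiable (at t within {0..})"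
    by metis
  have "\<forall>i. \<exists>S. locally_finite_times S \<and> continuous_on ({0..} - S) (time_deriv (\<lambda>t. u t $ i))"
    using assms(5) unfolding piecewise_cont_differentiable_def piecewise_continuous_def by blast
  then obtain Sc where Sc: "\<And>i. locally_finite_times (Sc i)"
      "\<And>i. continuous_on ({0..} - Sc i) (time_deriv (\<lambda>t. u t $ i))"
    by metis
  obtain Sx where Sx: "locally_finite_times Sx"
      "\<And>t i. t \<in> {0..} - Sx \<Longrightarrow> ((\<lambda>s. x s $ i) has_real_derivative
              (time_deriv (\<lambda>s. u s $ i) t - \<alpha> * (x t $ i - u t $ i)
                 - \<beta> * (\<Sum>j\<in>UNIV. laplacian A $ i $ j * x t $ j) - v t $ i)) (at t within {0..})"
      "\<And>t i. t \<in> {0..} - Sx \<Longrightarrow> ((\<lambda>s. v s $ i) has_real_derivative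
              (\<alpha> * \<beta> * (\<Sum>j\<in>UNIV. laplacian A $ i $ j * x t $ j))) (at t within {0..})"
    and contx: "continuous_on {0..} x" and contv: "continuous_on {0..} v"
    using assms(9) unfolding consensus_trajectory_def by blast
  \<comment> \<open>The endpoint \<open>0\<close> is put among the exceptional times: elsewhere the one-sided derivatives within
    \<open>{0..}\<close> are ordinary ones.\<close>
  define S where "S = {0} \<union> Sx \<union> (\<Union>i\<in>UNIV. Sd i) \<union> (\<Union>i\<in>UNIV. Sc i)"
  have S: "locally_finite_times S"
    unfolding S_def
    by (intro locally_finite_times_Un locally_finite_times_UN Sx Sd Sc)
      (auto simp: locally_finite_times_def)
  have within: "at t within {0..} = at t" if "t > 0" for t :: real
    using that by (intro at_within_interior) simp
  define u' where "u' t = (\<chi> i. time_deriv (\<lambda>s. u s $ i) t)" for t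
  have du: "(u has_vector_derivative u' t) (at t)" if t: "t > 0" "t \<notin> S" for t
  proof (rule has_vector_derivative_vecI)
    fix i
    have "(\<lambda>t. u t $ i) differentiable (at t within {0..})"
      using Sd(2)[of t i] t by (auto simp: S_def)
    then have "((\<lambda>t. u t $ i) has_vector_derivative time_deriv (\<lambda>s. u s $ i) t) (at t within {0..})"
      unfolding time_deriv_def by (simp add: vector_derivative_works)
    then show "((\<lambda>s. u s $ i) has_real_derivative u' t $ i) (at t)"
      using t by (simp add: within u'_def has_real_derivative_iff_has_vector_derivative)
  qed
  have dx: "(x has_vector_derivative
        u' t - \<alpha> *\<^sub>R (x t - u t) - \<beta> *\<^sub>R (laplacian A *v x t) - v t) (at t)"
    if t: "t > 0" "t \<notin> S" for t
    by (rule has_vector_derivative_vecI)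
      (use Sx(2)[of t] t in \<open>simp add: S_def within u'_def matrix_vector_mult_def\<close>)
  have dv: "(v has_vector_derivative (\<alpha> * \<beta>) *\<^sub>R (laplacian A *v x t)) (at t)"
    if t: "t > 0" "t \<notin> S" for t
    by (rule has_vector_derivative_vecI)
      (use Sx(3)[of t] t in \<open>simp add: S_def within matrix_vector_mult_def\<close>)
  have td: "time_deriv u t = u' t" if "t > 0" "t \<notin> S" for t
    using time_deriv_eqI[of t u "u' t"] du[OF that] that by (simp add: within)
  have "continuous_on ({0..} - S) u'"
    unfolding u'_def
    by (intro continuous_on_vec_lambda continuous_on_subset[OF Sc(2)]) (auto simp: S_def)
  then have "continuous_on ({0..} - S) (\<lambda>t. Pi_matrix *v u' t)"
    by (intro bounded_linear.continuous_on[OF matrix_vector_mul_bounded_linear])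
  then have contPi: "continuous_on ({0..} - S) (\<lambda>t. Pi_matrix *v time_deriv u t)"
  proof (rule continuous_on_eq)
    show "Pi_matrix *v u' t = Pi_matrix *v time_deriv u t" if "t \<in> {0..} - S" for t
      using that td[of t] by (cases "t = 0") (auto simp: S_def)
  qed
  have bound: "norm (Pi_matrix *v u' t) \<le> \<gamma>" if "t > 0" "t \<notin> S" for t
    using ess_norm_pointwise_bound[OF assms(6) S contPi that] td[OF that] by simp
  \<comment> \<open>\<open>\<gamma>\<close> bounds a norm at some time, since the exceptional times do not exhaust \<open>{0<..<1}\<close>\<close>
  have "infinite ({0<..<1::real})" by (simp add: infinite_Ioo)
  moreover have "finite (S \<inter> {0..1})" using S by (simp add: locally_finite_times_def)
  ultimately have "\<not> {0<..<1} \<subseteq> S \<inter> {0..1}" using finite_subset by blast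
  then obtain t0 where "t0 \<in> {0<..<1}" "t0 \<notin> S \<inter> {0..1}" by blast
  then have t0: "t0 > 0" "t0 \<notin> S" by auto
  have \<gamma>: "\<gamma> \<ge> 0" using bound[OF t0] norm_ge_zero order_trans by blast
  have contu: "continuous_on {0..} u"
    using continuous_on_vec_lambda[of "{0..}" "\<lambda>i t. u t $ i"] assms(5)
    by (simp add: piecewise_cont_differentiable_def)
  note gap = lambda2_hat_gap[OF assms(1-4)]
  show ?thesis
  proof (intro allI, unfold Limsup_le_iff, intro allI impI)
    fix i :: 'n and y :: ereal
    assume "ereal (inverse (\<beta> * lambda2_hat A) * \<gamma>) < y"
    then obtain c where c: "inverse (\<beta> * lambda2_hat A) * \<gamma> < c" "ereal c < y"
      using ereal_dense2 by (metis less_ereal.simps(1))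
    have "eventually (\<lambda>t. \<bar>x t $ i - (1 \<bullet> u t) / real CARD('n)\<bar> < c) at_top"
      by (rule consensus_error_eventually_less[OF gap(2,1) assms(4) S assms(7,8) \<gamma> contu contx contv du dx dv bound])
        (use c assms(10) in \<open>auto simp: inner_one_vec field_simps\<close>)
    then show "eventually (\<lambda>t. ereal \<bar>x t $ i - (1 / real CARD('n)) * (\<Sum>j\<in>UNIV. u t $ j)\<bar> < y) at_top"
    proof eventually_elim
      case (elim t)
      then show ?case using c(2) by (auto simp: inner_one_vec intro: less_trans[of _ "ereal c"])
    qed
  qed
qed

end
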